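(* (a) Let $\mathbf P=(P,\le,{}',0,1)$ be a bounded orthogonal saturated poset. Then the following three statements are equivalent: (1) the generalized Sasaki operations $\odot$ and $\to$ form an adjoint pair; (2) $\operatorname{Min}U(x,y')=y'\vee\big(\operatorname{Min}U(x,y')\wedge y\big)$ and $x\wedge\big(\operatorname{Max}L(x,y)\vee x'\big)=\operatorname{Max}L(x,y)$ for all $x,y\in P$; (3) for all $x,y\in P$: $x'\le y$ implies $y=x'\vee(y\wedge x)$, and $x\le y$ implies $x=(y'\vee x)\wedge y$. (b) Every orthomodular poset is a bounded orthogonal poset satisfying the two implications in (3). Consequently, in every saturated orthomodular poset the generalized Sasaki operations form an adjoint pair.
   Context: A bounded poset $(P,\le,0,1)$ has least element $0$ and greatest element $1$; $'$ is a unary operation on $P$. For $x,y\in P$, $L(x,y)$ and $U(x,y)$ denote the sets of all common lower bounds, respectively common upper bounds, of $x$ and $y$; $\operatorname{Max}A$ and $\operatorname{Min}A$ denote the sets of maximal, respectively minimal, elements of $A\subseteq P$. $x\vee y$ and $x\wedge y$ denote supremum and infimum in $P$ and are said to be defined if they exist. For $A\subseteq P$ and $b\in P$, $A\vee b=b\vee A:=\{a\vee b\mid a\in A\}$ and $A\wedge b=b\wedge A:=\{a\wedge b\mid a\in A\}$. The poset is saturated if for all $x,y\in P$: every element of $L(x,y)$ lies below some element of $\operatorname{Max}L(x,y)$, and every element of $U(x,y)$ lies above some element of $\operatorname{Min}U(x,y)$. $(P,\le,{}')$ is orthogonal if for all $a,b\in P$: if $a\le b$ then $a\vee b'$ is defined;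 and if $a'\le b$ then $a\wedge b$ is defined. (In a bounded orthogonal saturated poset all joins and meets occurring in the claim and in the definitions below exist.) The generalized Sasaki operations assign to $x,y\in P$ the subsets $x\odot y:=\operatorname{Min}U(x,y')\wedge y$ and $x\to y:=x'\vee\operatorname{Max}L(x,y)$ of $P$. For $A\subseteq P$ and $x,z\in P$: $A\le_2 z$ means that there is $a\in A$ with $a\le z$; $x\le_1 A$ means that there is $a\in A$ with $x\le a$. The generalized Sasaki operations form an adjoint pair if for all $x,y,z\in P$: $x\odot y\le_2 z$ if and only if $x\le_1 y\to z$. An orthomodular poset is a bounded poset $(P,\le,{}',0,1)$ with an antitone involution $'$ that is a complementation (i.e. $x\vee x'=1$ and $x\wedge x'=0$ for all $x$) such that for all $x,y\in P$: if $x\le y'$ then $x\vee y$ is defined; and if $x\le y$ then $y=x\vee(y'\vee x)'$. *)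

theory Defs
  imports Main
begin

text \<open>
  A bounded poset is a type of sort \<open>{order_bot, order_top}\<close>, with \<open>bot\<close> and \<open>top\<close> in the
  roles of \<open>0\<close> and \<open>1\<close>. The unary operation \<open>'\<close> is an explicit argument \<open>c\<close>; it is
  arbitrary unless a definition says otherwise.
\<close>

definition lower_bounds :: "'a::order \<Rightarrow> 'a \<Rightarrow> 'a set" where
  "lower_bounds x y = {z. z \<le> x \<and> z \<le> y}"

definition upper_bounds :: "'a::order \<Rightarrow> 'a \<Rightarrow> 'a set" where
  "upper_bounds x y = {z. x \<le> z \<and> y \<le> z}"

definition maximals :: "'a::order set \<Rightarrow> 'a set" where
  "maximals A = {m \<in> A. \<not> (\<exists>a\<in>A. m < a)}"

definition minimals :: "'a::order set \<Rightarrow> 'a set" where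
  "minimals A = {m \<in> A. \<not> (\<exists>a\<in>A. a < m)}"

definition is_join :: "'a::order \<Rightarrow> 'a \<Rightarrow> 'a \<Rightarrow> bool" where
  "is_join x y s \<longleftrightarrow> s \<in> upper_bounds x y \<and> (\<forall>u \<in> upper_bounds x y. s \<le> u)"

definition is_meet :: "'a::order \<Rightarrow> 'a \<Rightarrow> 'a \<Rightarrow> bool" where
  "is_meet x y s \<longleftrightarrow> s \<in> lower_bounds x y \<and> (\<forall>l \<in> lower_bounds x y. l \<le> s)"

definition join_defined :: "'a::order \<Rightarrow> 'a \<Rightarrow> bool" where
  "join_defined x y \<longleftrightarrow> (\<exists>s. is_join x y s)"

definition meet_defined :: "'a::order \<Rightarrow> 'a \<Rightarrow> bool" where
  "meet_defined x y \<longleftrightarrow> (\<exists>s. is_meet x y s)"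

text \<open>
  The values of \<open>\<squnion>\<close> and \<open>\<sqinter>\<close> are unspecified where the supremum or infimum does not
  exist. An equation \<open>x \<squnion> y = z\<close> therefore carries no existence claim; where existence is
  not guaranteed by the other hypotheses, \<open>is_join\<close> and \<open>is_meet\<close> are used instead.
\<close>

definition join :: "'a::order \<Rightarrow> 'a \<Rightarrow> 'a" (infixl "\<squnion>" 65) where
  "x \<squnion> y = (THE s. is_join x y s)"

definition meet :: "'a::order \<Rightarrow> 'a \<Rightarrow> 'a" (infixl "\<sqinter>" 70) where
  "x \<sqinter> y = (THE s. is_meet x y s)"

text \<open>
  \<open>set_join A b\<close> stands for both \<open>A \<or> b\<close> and \<open>b \<or> A\<close>, which are equal by definition;
  likewise \<open>set_meet\<close>.
\<close>

definition set_join :: "'a::order set \<Rightarrow> 'a \<Rightarrow> 'a set" where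
  "set_join A b = {a \<squnion> b | a. a \<in> A}"

definition set_meet :: "'a::order set \<Rightarrow> 'a \<Rightarrow> 'a set" where
  "set_meet A b = {a \<sqinter> b | a. a \<in> A}"

definition saturated :: "'a::order itself \<Rightarrow> bool" where
  "saturated _ \<longleftrightarrow> (\<forall>x y :: 'a.
     (\<forall>z \<in> lower_bounds x y. \<exists>m \<in> maximals (lower_bounds x y). z \<le> m) \<and>
     (\<forall>z \<in> upper_bounds x y. \<exists>m \<in> minimals (upper_bounds x y). m \<le> z))"

definition orthogonal :: "('a::order \<Rightarrow> 'a) \<Rightarrow> bool" where
  "orthogonal c \<longleftrightarrow> (\<forall>a b.
     (a \<le> b \<longrightarrow> join_defined a (c b)) \<and>
     (c a \<le> b \<longrightarrow> meet_defined a b))"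

definition sasaki_times :: "('a::order \<Rightarrow> 'a) \<Rightarrow> 'a \<Rightarrow> 'a \<Rightarrow> 'a set" where
  "sasaki_times c x y = set_meet (minimals (upper_bounds x (c y))) y"

definition sasaki_imp :: "('a::order \<Rightarrow> 'a) \<Rightarrow> 'a \<Rightarrow> 'a \<Rightarrow> 'a set" where
  "sasaki_imp c x y = set_join (maximals (lower_bounds x y)) (c x)"

definition le2 :: "'a::order set \<Rightarrow> 'a \<Rightarrow> bool" (infix "\<le>\<^sub>2" 50) where
  "A \<le>\<^sub>2 z \<longleftrightarrow> (\<exists>a\<in>A. a \<le> z)"

definition le1 :: "'a::order \<Rightarrow> 'a set \<Rightarrow> bool" (infix "\<le>\<^sub>1" 50) where
  "x \<le>\<^sub>1 A \<longleftrightarrow> (\<exists>a\<in>A. x \<le> a)"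

definition sasaki_adjoint :: "('a::order \<Rightarrow> 'a) \<Rightarrow> bool" where
  "sasaki_adjoint c \<longleftrightarrow>
     (\<forall>x y z. sasaki_times c x y \<le>\<^sub>2 z \<longleftrightarrow> x \<le>\<^sub>1 sasaki_imp c y z)"

text \<open>
  Under \<open>orthogonal c\<close> all joins and meets in the following two definitions exist.
\<close>

definition sasaki_identities :: "('a::order \<Rightarrow> 'a) \<Rightarrow> bool" where
  "sasaki_identities c \<longleftrightarrow> (\<forall>x y.
     minimals (upper_bounds x (c y)) = set_join (set_meet (minimals (upper_bounds x (c y))) y) (c y) \<and>
     set_meet (set_join (maximals (lower_bounds x y)) (c x)) x = maximals (lower_bounds x y))"

definition orthomodular_implications :: "('a::order \<Rightarrow> 'a) \<Rightarrow> bool" where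
  "orthomodular_implications c \<longleftrightarrow> (\<forall>x y.
     (c x \<le> y \<longrightarrow> y = c x \<squnion> (y \<sqinter> x)) \<and>
     (x \<le> y \<longrightarrow> x = (c y \<squnion> x) \<sqinter> y))"

text \<open>
  In the last clause below both joins exist by the preceding clauses: \<open>x \<le> y\<close> gives
  \<open>c y \<le> c x\<close>, and \<open>x \<le> c y \<squnion> x = c (c (c y \<squnion> x))\<close>.
\<close>

definition orthomodular :: "('a::{order_bot,order_top} \<Rightarrow> 'a) \<Rightarrow> bool" where
  "orthomodular c \<longleftrightarrow>
     antimono c \<and> (\<forall>x. c (c x) = x) \<and>
     (\<forall>x. is_join x (c x) top \<and> is_meet x (c x) bot) \<and>
     (\<forall>x y. x \<le> c y \<longrightarrow> join_defined x y) \<and>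
     (\<forall>x y. x \<le> y \<longrightarrow> y = x \<squnion> c (c y \<squnion> x))"

end

theory Submission
  imports Defs
begin

text \<open>
  The two implications say that \<open>\<lambda>u. c y \<squnion> (u \<sqinter> y)\<close> fixes every \<open>u\<close> above \<open>c y\<close> and
  that \<open>\<lambda>m. (m \<squnion> c y) \<sqinter> y\<close> fixes every \<open>m\<close> below \<open>y\<close>: the maps \<open>u \<mapsto> u \<sqinter> y\<close> and
  \<open>m \<mapsto> m \<squnion> c y\<close> are mutually inverse between the elements above \<open>c y\<close> and those below \<open>y\<close>.
  Orthogonality makes both maps total on these domains, so no other joins or meets ever occur.

  The implications give the identities, since \<open>minimals (upper_bounds x (c y))\<close> lies above
  \<open>c y\<close> and \<open>maximals (lower_bounds x y)\<close> lies below \<open>x\<close>. They give adjointness too: because the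
  two maps are monotone and mutually inverse, \<open>u \<sqinter> y \<le> m\<close> and \<open>u \<le> m \<squnion> c y\<close> are equivalent, and
  saturation supplies the \<open>m\<close> or the \<open>u\<close> that adjointness asks for.

  Both converses specialize to comparable elements. There the set of bounds has a least or
  greatest element, the Sasaki operations become singletons, and adjointness or the identities
  speak about a single join and a single meet.

  For an orthomodular poset, the involution turns joins into meets. Orthogonality and the first
  implication are then the defining clauses read through De Morgan's law, and the second
  implication is the complement of the orthomodular law for \<open>c y \<le> c x\<close>.
\<close>

section \<open>Joins and meets that exist\<close>

lemma is_join_unique: "is_join x y s \<Longrightarrow> is_join x y t \<Longrightarrow> s = t"
  unfolding is_join_def by (meson order.antisym)

lemma is_meet_unique: "is_meet x y s \<Longrightarrow> is_meet x y t \<Longrightarrow> s = t"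
  unfolding is_meet_def by (meson order.antisym)

lemma join_eqI: "is_join x y s \<Longrightarrow> x \<squnion> y = s"
  unfolding join_def by (blast intro: the_equality is_join_unique)

lemma meet_eqI: "is_meet x y s \<Longrightarrow> x \<sqinter> y = s"
  unfolding meet_def by (blast intro: the_equality is_meet_unique)

lemma is_join_join: "join_defined x y \<Longrightarrow> is_join x y (x \<squnion> y)"
  unfolding join_defined_def using join_eqI by blast

lemma is_meet_meet: "meet_defined x y \<Longrightarrow> is_meet x y (x \<sqinter> y)"
  unfolding meet_defined_def using meet_eqI by blast

lemma join_commute: "x \<squnion> y = y \<squnion> x"
  unfolding join_def is_join_def upper_bounds_def by (simp add: conj_commute)

lemma meet_commute: "x \<sqinter> y = y \<sqinter> x"
  unfolding meet_def is_meet_def lower_bounds_def by (simp add: conj_commute)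

lemma minimals_upper_bounds_absorb:
  assumes "y \<le> x"
  shows "minimals (upper_bounds x y) = {x}"
  using assms unfolding minimals_def upper_bounds_def by (auto simp: order.order_iff_strict)

lemma maximals_lower_bounds_absorb:
  assumes "y \<le> x"
  shows "maximals (lower_bounds x y) = {y}"
  using assms unfolding maximals_def lower_bounds_def by (auto simp: order.order_iff_strict)

section \<open>The equivalence in orthogonal saturated posets\<close>

lemma orthogonal_is_join:
  assumes "orthogonal c" and "m \<le> y"
  shows "is_join m (c y) (m \<squnion> c y)"
  using assms is_join_join unfolding orthogonal_def by blast

text \<open>
  Orthogonality provides the meet of \<open>y\<close> and \<open>u\<close>, in this order, while the Sasaki product
  uses the opposite order.
\<close>
lemma orthogonal_is_meet:
  assumes "orthogonal c" and "c y \<le> u"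
  shows "is_meet u y (u \<sqinter> y)"
proof -
  have "is_meet y u (y \<sqinter> u)"
    using assms is_meet_meet unfolding orthogonal_def by blast
  then show ?thesis
    unfolding meet_commute[of y u] is_meet_def lower_bounds_def by blast
qed

text \<open>
  The two fixed-point equations give both halves of the equivalence by monotonicity:
  joining \<open>u \<sqinter> y \<le> m\<close> with \<open>c y\<close> recovers \<open>u\<close> on the left, and meeting \<open>u \<le> m \<squnion> c y\<close> with
  \<open>y\<close> recovers \<open>m\<close> on the right. Adjointness of the Sasaki operations is the extension of this
  equivalence from elements to sets of bounds.
\<close>
lemma orthomodular_implications_galois:
  assumes "orthogonal c" and "orthomodular_implications c"
    and "c y \<le> u" and "m \<le> y"
  shows "u \<sqinter> y \<le> m \<longleftrightarrow> u \<le> m \<squnion> c y"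
proof -
  have uy: "is_meet u y (u \<sqinter> y)"
    using assms(1,3) by (rule orthogonal_is_meet)
  then have "u \<sqinter> y \<le> y"
    by (simp add: is_meet_def lower_bounds_def)
  then have uyc: "is_join (u \<sqinter> y) (c y) (u \<sqinter> y \<squnion> c y)"
    by (rule orthogonal_is_join[OF assms(1)])
  have my: "is_join m (c y) (m \<squnion> c y)"
    using assms(1,4) by (rule orthogonal_is_join)
  then have "c y \<le> m \<squnion> c y"
    by (simp add: is_join_def upper_bounds_def)
  then have myc: "is_meet (m \<squnion> c y) y ((m \<squnion> c y) \<sqinter> y)"
    by (rule orthogonal_is_meet[OF assms(1)])
  have u: "u \<sqinter> y \<squnion> c y = u" and m: "(m \<squnion> c y) \<sqinter> y = m"
    using assms(2-4) unfolding orthomodular_implications_def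
    by (metis join_commute)+
  show ?thesis
  proof
    assume "u \<sqinter> y \<le> m"
    then have "m \<squnion> c y \<in> upper_bounds (u \<sqinter> y) (c y)"
      using my unfolding is_join_def upper_bounds_def by (auto intro: order.trans)
    then show "u \<le> m \<squnion> c y"
      using uyc u unfolding is_join_def by force
  next
    assume "u \<le> m \<squnion> c y"
    then have "u \<sqinter> y \<in> lower_bounds (m \<squnion> c y) y"
      using uy unfolding is_meet_def lower_bounds_def by (auto intro: order.trans)
    then show "u \<sqinter> y \<le> m"
      using myc m unfolding is_meet_def by force
  qed
qed

text \<open>
  Saturation moves between the given bound and an extremal one: \<open>u \<sqinter> y\<close> is a lower bound of
  \<open>y\<close> and \<open>z\<close>, so it lies below some maximal \<open>m\<close>; dually, \<open>m \<squnion> c y\<close> lies above some minimal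
  upper bound \<open>u\<close> of \<open>x\<close> and \<open>c y\<close>.
\<close>
lemma orthomodular_implications_imp_adjoint:
  fixes c :: "'a::order \<Rightarrow> 'a"
  assumes orth: "orthogonal c" and sat: "saturated TYPE('a)"
    and impl: "orthomodular_implications c"
  shows "sasaki_adjoint c"
  unfolding sasaki_adjoint_def
proof (intro allI iffI)
  fix x y z :: 'a
  assume "sasaki_times c x y \<le>\<^sub>2 z"
  then obtain u where u: "u \<in> minimals (upper_bounds x (c y))" and "u \<sqinter> y \<le> z"
    unfolding sasaki_times_def set_meet_def le2_def by blast
  then have "x \<le> u" and "c y \<le> u"
    by (auto simp: minimals_def upper_bounds_def)
  then have "u \<sqinter> y \<in> lower_bounds y z"
    using orthogonal_is_meet[OF orth] \<open>u \<sqinter> y \<le> z\<close>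
    by (simp add: is_meet_def lower_bounds_def)
  then obtain m where m: "m \<in> maximals (lower_bounds y z)" and "u \<sqinter> y \<le> m"
    using sat unfolding saturated_def by meson
  then have "m \<le> y"
    by (simp add: maximals_def lower_bounds_def)
  then have "u \<le> m \<squnion> c y"
    using orthomodular_implications_galois[OF orth impl \<open>c y \<le> u\<close>] \<open>u \<sqinter> y \<le> m\<close> by blast
  then have "x \<le> m \<squnion> c y"
    using \<open>x \<le> u\<close> by (rule order.trans[rotated])
  then show "x \<le>\<^sub>1 sasaki_imp c y z"
    using m unfolding sasaki_imp_def set_join_def le1_def by blast
next
  fix x y z :: 'a
  assume "x \<le>\<^sub>1 sasaki_imp c y z"
  then obtain m where m: "m \<in> maximals (lower_bounds y z)" and "x \<le> m \<squnion> c y"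
    unfolding sasaki_imp_def set_join_def le1_def by blast
  then have "m \<le> y" and "m \<le> z"
    by (auto simp: maximals_def lower_bounds_def)
  then have "m \<squnion> c y \<in> upper_bounds x (c y)"
    using orthogonal_is_join[OF orth] \<open>x \<le> m \<squnion> c y\<close>
    by (simp add: is_join_def upper_bounds_def)
  then obtain u where u: "u \<in> minimals (upper_bounds x (c y))" and "u \<le> m \<squnion> c y"
    using sat unfolding saturated_def by meson
  then have "c y \<le> u"
    by (simp add: minimals_def upper_bounds_def)
  then have "u \<sqinter> y \<le> m"
    using orthomodular_implications_galois[OF orth impl _ \<open>m \<le> y\<close>] \<open>u \<le> m \<squnion> c y\<close> by blast
  then have "u \<sqinter> y \<le> z"
    using \<open>m \<le> z\<close> by (rule order.trans)
  then show "sasaki_times c x y \<le>\<^sub>2 z"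
    using u unfolding sasaki_times_def set_meet_def le2_def by blast
qed

text \<open>
  Each implication is one direction of adjointness applied to a pair for which the other side
  holds by reflexivity: \<open>sasaki_times c y x = {y \<sqinter> x}\<close> against the bound \<open>y \<sqinter> x\<close>, and
  \<open>c y \<squnion> x\<close> against \<open>sasaki_imp c y x = {x \<squnion> c y}\<close>.
\<close>
lemma adjoint_imp_orthomodular_implications:
  fixes c :: "'a::order \<Rightarrow> 'a"
  assumes orth: "orthogonal c" and adj: "sasaki_adjoint c"
  shows "orthomodular_implications c"
  unfolding orthomodular_implications_def
proof (intro allI conjI impI)
  fix x y :: 'a
  assume cxy: "c x \<le> y"
  have "is_meet y x (y \<sqinter> x)"
    using orth cxy by (rule orthogonal_is_meet)
  then have le: "y \<sqinter> x \<le> y" "y \<sqinter> x \<le> x"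
    by (auto simp: is_meet_def lower_bounds_def)
  have "sasaki_times c y x \<le>\<^sub>2 y \<sqinter> x"
    using minimals_upper_bounds_absorb[OF cxy]
    by (simp add: sasaki_times_def set_meet_def le2_def)
  then have "y \<le>\<^sub>1 sasaki_imp c x (y \<sqinter> x)"
    using adj unfolding sasaki_adjoint_def by blast
  then have "y \<le> y \<sqinter> x \<squnion> c x"
    using maximals_lower_bounds_absorb[OF le(2)]
    by (simp add: sasaki_imp_def set_join_def le1_def)
  moreover have "y \<sqinter> x \<squnion> c x \<le> y"
    using orthogonal_is_join[OF orth le(2)] le(1) cxy
    by (simp add: is_join_def upper_bounds_def)
  ultimately show "y = c x \<squnion> (y \<sqinter> x)"
    unfolding join_commute[of "c x"] by (rule order.antisym)
next
  fix x y :: 'a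
  assume xy: "x \<le> y"
  have "is_join x (c y) (x \<squnion> c y)"
    using orth xy by (rule orthogonal_is_join)
  then have le: "x \<le> x \<squnion> c y" "c y \<le> x \<squnion> c y"
    by (auto simp: is_join_def upper_bounds_def)
  have "x \<squnion> c y \<le>\<^sub>1 sasaki_imp c y x"
    using maximals_lower_bounds_absorb[OF xy]
    by (simp add: sasaki_imp_def set_join_def le1_def)
  then have "sasaki_times c (x \<squnion> c y) y \<le>\<^sub>2 x"
    using adj unfolding sasaki_adjoint_def by blast
  then have "(x \<squnion> c y) \<sqinter> y \<le> x"
    using minimals_upper_bounds_absorb[OF le(2)]
    by (simp add: sasaki_times_def set_meet_def le2_def)
  moreover have "x \<le> (x \<squnion> c y) \<sqinter> y"
    using orthogonal_is_meet[OF orth le(2)] le(1) xy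
    by (simp add: is_meet_def lower_bounds_def)
  ultimately show "x = (c y \<squnion> x) \<sqinter> y"
    unfolding join_commute[of "c y"] by (rule order.antisym[rotated])
qed

text \<open>
  From left to right, \<open>x \<le> y\<close> or \<open>c x \<le> y\<close> collapses the set of extremal bounds to a singleton.
  From right to left, both sides of each identity agree element by element.
\<close>
lemma sasaki_identities_iff_orthomodular_implications:
  fixes c :: "'a::order \<Rightarrow> 'a"
  shows "sasaki_identities c \<longleftrightarrow> orthomodular_implications c"
proof
  assume ids: "sasaki_identities c"
  show "orthomodular_implications c"
    unfolding orthomodular_implications_def
  proof (intro allI conjI impI)
    fix x y :: 'a
    assume "c x \<le> y"
    then have "minimals (upper_bounds y (c x)) = {y}"
      by (rule minimals_upper_bounds_absorb)
    moreover have "minimals (upper_bounds y (c x))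
        = set_join (set_meet (minimals (upper_bounds y (c x))) x) (c x)"
      using ids unfolding sasaki_identities_def by blast
    ultimately have "{y} = set_join (set_meet {y} x) (c x)"
      by simp
    then show "y = c x \<squnion> (y \<sqinter> x)"
      by (simp add: set_join_def set_meet_def join_commute)
  next
    fix x y :: 'a
    assume "x \<le> y"
    then have "maximals (lower_bounds y x) = {x}"
      by (rule maximals_lower_bounds_absorb)
    moreover have "set_meet (set_join (maximals (lower_bounds y x)) (c y)) y
        = maximals (lower_bounds y x)"
      using ids unfolding sasaki_identities_def by blast
    ultimately have "set_meet (set_join {x} (c y)) y = {x}"
      by simp
    then show "x = (c y \<squnion> x) \<sqinter> y"
      by (simp add: set_join_def set_meet_def join_commute)
  qed
next
  assume impl: "orthomodular_implications c"
  show "sasaki_identities c"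
    unfolding sasaki_identities_def
  proof (intro allI conjI)
    fix x y :: 'a
    let ?M = "minimals (upper_bounds x (c y))"
    have "u \<sqinter> y \<squnion> c y = u" if "u \<in> ?M" for u
    proof -
      have "c y \<le> u"
        using that by (simp add: minimals_def upper_bounds_def)
      then show ?thesis
        using impl unfolding orthomodular_implications_def by (metis join_commute)
    qed
    then have "(\<lambda>u. u \<sqinter> y \<squnion> c y) ` ?M = ?M"
      by simp
    moreover have "set_join (set_meet ?M y) (c y) = (\<lambda>u. u \<sqinter> y \<squnion> c y) ` ?M"
      unfolding set_join_def set_meet_def by blast
    ultimately show "?M = set_join (set_meet ?M y) (c y)"
      by simp
  next
    fix x y :: 'a
    let ?M = "maximals (lower_bounds x y)"
    have "(m \<squnion> c x) \<sqinter> x = m" if "m \<in> ?M" for m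
    proof -
      have "m \<le> x"
        using that by (simp add: maximals_def lower_bounds_def)
      then show ?thesis
        using impl unfolding orthomodular_implications_def by (metis join_commute)
    qed
    then have "(\<lambda>m. (m \<squnion> c x) \<sqinter> x) ` ?M = ?M"
      by simp
    moreover have "set_meet (set_join ?M (c x)) x = (\<lambda>m. (m \<squnion> c x) \<sqinter> x) ` ?M"
      unfolding set_join_def set_meet_def by blast
    ultimately show "set_meet (set_join ?M (c x)) x = ?M"
      by simp
  qed
qed

section \<open>Orthomodular posets\<close>

lemma antimono_involution_is_meet:
  assumes "antimono c" and "\<And>x. c (c x) = x" and "is_join (c x) (c y) s"
  shows "is_meet x y (c s)"
proof -
  have swap: "c a \<le> b" if "c b \<le> a" for a b
    using antimonoD[OF assms(1) that] assms(2) by simp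
  have swap': "b \<le> c a" if "a \<le> c b" for a b
    using antimonoD[OF assms(1) that] assms(2) by simp
  have "c s \<in> lower_bounds x y"
    using assms(3) swap unfolding is_join_def upper_bounds_def lower_bounds_def by blast
  moreover have "l \<le> c s" if "l \<in> lower_bounds x y" for l
  proof -
    have "c l \<in> upper_bounds (c x) (c y)"
      using that antimonoD[OF assms(1)] unfolding lower_bounds_def upper_bounds_def by blast
    then have "s \<le> c l"
      using assms(3) unfolding is_join_def by blast
    then show ?thesis
      by (rule swap')
  qed
  ultimately show ?thesis
    unfolding is_meet_def by blast
qed

lemma orthomodular_is_meet:
  assumes "orthomodular c" and "c x \<le> y"
  shows "is_meet x y (c (c x \<squnion> c y))"
proof -
  have "join_defined (c x) (c y)"
    using assms unfolding orthomodular_def by metis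
  then have "is_join (c x) (c y) (c x \<squnion> c y)"
    by (rule is_join_join)
  moreover have "antimono c" and "\<And>z. c (c z) = z"
    using assms(1) unfolding orthomodular_def by blast+
  ultimately show ?thesis
    by (intro antimono_involution_is_meet)
qed

lemma orthomodular_imp_orthogonal:
  fixes c :: "'a::{order_bot,order_top} \<Rightarrow> 'a"
  assumes "orthomodular c"
  shows "orthogonal c"
  unfolding orthogonal_def
proof (intro allI conjI impI)
  fix a b :: 'a
  assume "a \<le> b"
  then show "join_defined a (c b)"
    using assms unfolding orthomodular_def by metis
next
  fix a b :: 'a
  assume "c a \<le> b"
  then show "meet_defined a b"
    using orthomodular_is_meet[OF assms] unfolding meet_defined_def by blast
qed

lemma orthomodular_imp_orthomodular_implications:
  fixes c :: "'a::{order_bot,order_top} \<Rightarrow> 'a"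
  assumes "orthomodular c"
  shows "orthomodular_implications c"
proof -
  have anti: "antimono c" and inv: "\<And>x. c (c x) = x"
    and law: "\<And>x y. x \<le> y \<Longrightarrow> y = x \<squnion> c (c y \<squnion> x)"
    using assms unfolding orthomodular_def by blast+
  have de_morgan: "x \<sqinter> y = c (c x \<squnion> c y)" if "c x \<le> y" for x y
    using orthomodular_is_meet[OF assms that] by (rule meet_eqI)
  show ?thesis
    unfolding orthomodular_implications_def
  proof (intro allI conjI impI)
    fix x y :: 'a
    assume "c x \<le> y"
    then show "y = c x \<squnion> (y \<sqinter> x)"
      using law[of "c x" y] de_morgan[of x y]
      by (simp add: meet_commute[of y] join_commute[of "c y"])
  next
    fix x y :: 'a
    assume xy: "x \<le> y"
    \<comment> \<open>the orthomodular law for \<open>c y \<le> c x\<close>, which exhibits \<open>c x\<close> as the join whose complement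
      is the required meet\<close>
    have cx: "c x = c y \<squnion> c (x \<squnion> c y)"
      using law[OF antimonoD[OF anti xy]] inv by simp
    have "is_join x (c y) (x \<squnion> c y)"
      using orthomodular_imp_orthogonal[OF assms] xy by (rule orthogonal_is_join)
    then have "y \<sqinter> (x \<squnion> c y) = c (c y \<squnion> c (x \<squnion> c y))"
      by (intro de_morgan) (simp add: is_join_def upper_bounds_def)
    also have "\<dots> = x"
      using cx inv by metis
    finally show "x = (c y \<squnion> x) \<sqinter> y"
      by (simp add: join_commute meet_commute)
  qed
qed

theorem corollary4p3:
  fixes c :: "'a::{order_bot,order_top} \<Rightarrow> 'a"
  shows "(orthogonal c \<and> saturated TYPE('a) \<longrightarrow>
            (sasaki_adjoint c \<longleftrightarrow> sasaki_identities c) \<and>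
            (sasaki_identities c \<longleftrightarrow> orthomodular_implications c)) \<and>
         (orthomodular c \<longrightarrow> orthogonal c \<and> orthomodular_implications c) \<and>
         (saturated TYPE('a) \<and> orthomodular c \<longrightarrow> sasaki_adjoint c)"
  using orthomodular_implications_imp_adjoint[of c] adjoint_imp_orthomodular_implications[of c]
    sasaki_identities_iff_orthomodular_implications[of c]
    orthomodular_imp_orthogonal[of c] orthomodular_imp_orthomodular_implications[of c]
  by blast

end
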